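(* Let $G$ be a finite simple connected graph with $n$ vertices, $m$ edges, maximum degree $\Delta$ and minimum degree $\delta$. If $G$ is non-regular, then $$DSO(G) \le \frac{m}{\sqrt{2}} + \frac{1}{4\sqrt{2}\,\delta} \left( irr_t(G) - \frac{\bigl(n M_1(G)-4m^2\bigr)-\sigma(G)}{\Delta-\delta} \right).$$ If $G$ is regular, then $DSO(G)=m/\sqrt{2}$.
   Context: For a finite simple graph $G=(V(G),E(G))$, $d_u$ denotes the degree of the vertex $u$. The Diminished Sombor index is $DSO(G)=\sum_{uv\in E(G)}\frac{\sqrt{d_u^2+d_v^2}}{d_u+d_v}$. The first Zagreb index is $M_1(G)=\sum_{v\in V(G)} d_v^2$, the sigma irregularity index is $\sigma(G)=\sum_{uv\in E(G)} (d_u-d_v)^2$, and the total irregularity index is $irr_t(G)=\sum_{\{u,v\}\subseteq V(G)} |d_u-d_v|$, where the sum runs over all unordered pairs of distinct vertices. *)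

theory Defs
  imports Complex_Main "Graph_Theory.Graph_Theory"
begin

text \<open>
  A finite simple graph is represented by the locale \<open>graph\<close>: a finite, loop-free digraph without
  parallel arcs whose arc relation is symmetric. An undirected edge \<open>uv\<close> thus corresponds to the
  two opposite arcs between \<open>u\<close> and \<open>v\<close>, and it is counted once, as the two-element set \<open>{u, v}\<close>.
  The degree of a vertex in the undirected sense is its out-degree (which equals its in-degree),
  and \<open>Digraph_Component.connected\<close> (which includes having at least one vertex) is the
  usual connectedness.
\<close>

definition edges :: "('a, 'b) pre_digraph \<Rightarrow> 'a set set" where
  "edges G = {{u, v} | u v. u \<rightarrow>\<^bsub>G\<^esub> v}"

definition vertex_pairs :: "('a, 'b) pre_digraph \<Rightarrow> 'a set set" where
  "vertex_pairs G = {{u, v} | u v. u \<in> verts G \<and> v \<in> verts G \<and> u \<noteq> v}"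

abbreviation deg :: "('a, 'b) pre_digraph \<Rightarrow> 'a \<Rightarrow> nat" where
  "deg G v \<equiv> out_degree G v"

definition max_degree :: "('a, 'b) pre_digraph \<Rightarrow> nat" where
  "max_degree G = Max (deg G ` verts G)"

definition min_degree :: "('a, 'b) pre_digraph \<Rightarrow> nat" where
  "min_degree G = Min (deg G ` verts G)"

definition regular :: "('a, 'b) pre_digraph \<Rightarrow> bool" where
  "regular G \<longleftrightarrow> (\<exists>k. \<forall>v \<in> verts G. deg G v = k)"

text \<open>
  The value of a symmetric function \<open>f\<close> on an unordered pair; the lemma below shows that
  it does not depend on the order in which the pair is written.
\<close>

definition on_pair :: "('a \<Rightarrow> 'a \<Rightarrow> 'c) \<Rightarrow> 'a set \<Rightarrow> 'c" where
  "on_pair f e = (THE x. \<exists>u v. e = {u, v} \<and> x = f u v)"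

lemma on_pair_eq:
  assumes "\<And>u v. f u v = f v u"
  shows "on_pair f {u, v} = f u v"
  unfolding on_pair_def
proof (rule the_equality)
  fix x
  assume "\<exists>a b. {u, v} = {a, b} \<and> x = f a b"
  then show "x = f u v"
    using assms by (auto simp: doubleton_eq_iff)
qed blast

definition diminished_sombor :: "('a, 'b) pre_digraph \<Rightarrow> real" where
  "diminished_sombor G =
     (\<Sum>e \<in> edges G.
        on_pair (\<lambda>u v. sqrt ((real (deg G u))\<^sup>2 + (real (deg G v))\<^sup>2) / (real (deg G u) + real (deg G v))) e)"

definition first_zagreb :: "('a, 'b) pre_digraph \<Rightarrow> real" where
  "first_zagreb G = (\<Sum>v \<in> verts G. (real (deg G v))\<^sup>2)"

definition sigma_irregularity :: "('a, 'b) pre_digraph \<Rightarrow> real" where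
  "sigma_irregularity G =
     (\<Sum>e \<in> edges G. on_pair (\<lambda>u v. (real (deg G u) - real (deg G v))\<^sup>2) e)"

definition total_irregularity :: "('a, 'b) pre_digraph \<Rightarrow> real" where
  "total_irregularity G =
     (\<Sum>e \<in> vertex_pairs G. on_pair (\<lambda>u v. \<bar>real (deg G u) - real (deg G v)\<bar>) e)"

end

theory Submission
  imports Defs
begin

text \<open>
  Write \<open>t = \<bar>d\<^sub>u - d\<^sub>v\<bar>\<close> and \<open>s = d\<^sub>u + d\<^sub>v\<close> for a pair of vertices. The proof bounds both sides
  of the inequality through the sum of \<open>t\<close> over the edges.

  On the left, \<open>2 (d\<^sub>u\<^sup>2 + d\<^sub>v\<^sup>2) = s\<^sup>2 + t\<^sup>2 \<le> (s + t / 2)\<^sup>2\<close> because \<open>t \<le> s\<close>, and \<open>s \<ge> 2 \<delta>\<close>. So an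
  edge contributes at most \<open>1 / \<surd>2 + t / (4 \<surd>2 \<delta>)\<close> to the diminished Sombor index
  (\<open>sombor_term_le\<close>). Here \<open>\<delta> > 0\<close>, because a connected graph with an isolated vertex has no other
  vertex and is therefore regular (\<open>deg_pos\<close>).

  On the right, Lagrange's identity and the handshake lemma turn \<open>n M\<^sub>1 - 4 m\<^sup>2\<close> into the sum of
  \<open>t\<^sup>2\<close> over all pairs of vertices (\<open>sum_pairs_squared_difference\<close>). Subtracting \<open>\<sigma>\<close> leaves the sum
  over the non-adjacent pairs, where \<open>t\<^sup>2 \<le> (\<Delta> - \<delta>) t\<close>. After division by \<open>\<Delta> - \<delta>\<close> this is at most the
  share of the non-adjacent pairs in the total irregularity, so the parenthesis of the claimed bound
  is at least the sum of \<open>t\<close> over the edges (\<open>sum_edges_difference_le\<close>).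
\<close>

section \<open>Sums over unordered pairs\<close>

text \<open>
  Each unordered pair comes from exactly two ordered ones. With the arcs and with the off-diagonal
  pairs of vertices as \<open>R\<close>, this gives the handshake lemma and the sum of squared differences.
\<close>

lemma sum_ordered_pairs_eq_twice_unordered:
  fixes f :: "'a \<Rightarrow> 'a \<Rightarrow> real"
  assumes "finite R" and "sym R" and "irrefl R" and f_sym: "\<And>u v. f u v = f v u"
  shows "(\<Sum>(u, v)\<in>R. f u v) = 2 * (\<Sum>e\<in>{{u, v} | u v. (u, v) \<in> R}. on_pair f e)"
proof -
  define pair where "pair = (\<lambda>(u, v). {u, v :: 'a})"
  have image: "{{u, v} | u v. (u, v) \<in> R} = pair ` R"
    by (force simp: pair_def)
  have fibre: "(\<Sum>(u, v)\<in>{x \<in> R. pair x = e}. f u v) = 2 * on_pair f e" if "e \<in> pair ` R" for e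
  proof -
    from that obtain u v where uv: "(u, v) \<in> R" "e = {u, v}"
      by (auto simp: pair_def)
    with assms have "u \<noteq> v" "(v, u) \<in> R"
      by (auto simp: irrefl_def dest: symD)
    with uv have "{x \<in> R. pair x = e} = {(u, v), (v, u)}"
      by (auto simp: pair_def doubleton_eq_iff)
    with \<open>u \<noteq> v\<close> uv show ?thesis
      using f_sym by (simp add: on_pair_eq)
  qed
  have "(\<Sum>(u, v)\<in>R. f u v) = (\<Sum>e\<in>pair ` R. \<Sum>(u, v)\<in>{x \<in> R. pair x = e}. f u v)"
    using \<open>finite R\<close> by (rule sum.image_gen)
  also have "\<dots> = 2 * (\<Sum>e\<in>pair ` R. on_pair f e)"
    by (simp add: fibre sum_distrib_left)
  finally show ?thesis
    by (simp add: image)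
qed

text \<open>Lagrange's identity for the vectors \<open>x\<close> and \<open>(1, \<dots>, 1)\<close>.\<close>

lemma sum_squared_differences:
  fixes x :: "'a \<Rightarrow> real"
  assumes "finite V"
  shows "(\<Sum>u\<in>V. \<Sum>v\<in>V. (x u - x v)\<^sup>2) = 2 * (real (card V) * (\<Sum>v\<in>V. (x v)\<^sup>2) - (\<Sum>v\<in>V. x v)\<^sup>2)"
proof -
  have "(\<Sum>u\<in>V. \<Sum>v\<in>V. (x u - x v)\<^sup>2)
      = (\<Sum>u\<in>V. \<Sum>v\<in>V. (x u)\<^sup>2) + (\<Sum>u\<in>V. \<Sum>v\<in>V. (x v)\<^sup>2) - 2 * (\<Sum>u\<in>V. \<Sum>v\<in>V. x u * x v)"
    by (simp add: power2_diff sum.distrib sum_subtractf sum_distrib_left mult.assoc)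
  also have "(\<Sum>u\<in>V. \<Sum>v\<in>V. x u * x v) = (\<Sum>v\<in>V. x v)\<^sup>2"
    by (simp add: power2_eq_square sum_product)
  finally show ?thesis
    by (simp add: sum_distrib_left[symmetric])
qed

section \<open>Edges and degrees\<close>

lemma vertex_pairs_conv:
  "vertex_pairs G = {{u, v} | u v. (u, v) \<in> {(u, v). u \<in> verts G \<and> v \<in> verts G \<and> u \<noteq> v}}"
  by (simp add: vertex_pairs_def)

lemma (in fin_digraph) finite_arcs_ends: "finite (arcs_ends G)"
  by (simp add: arcs_ends_def)

lemma (in fin_digraph) finite_vertex_pairs: "finite (vertex_pairs G)"
  by (rule finite_subset[of _ "Pow (verts G)"]) (auto simp: vertex_pairs_def)

lemma (in digraph) edges_subset_vertex_pairs: "edges G \<subseteq> vertex_pairs G"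
  unfolding edges_def vertex_pairs_def using adj_in_verts adj_not_same by blast

lemma (in fin_digraph) min_degree_le_deg: "v \<in> verts G \<Longrightarrow> min_degree G \<le> deg G v"
  by (simp add: min_degree_def)

lemma (in fin_digraph) deg_le_max_degree: "v \<in> verts G \<Longrightarrow> deg G v \<le> max_degree G"
  by (simp add: max_degree_def)

lemma (in graph) sum_arcs_ends_eq_twice_sum_edges:
  fixes f :: "'a \<Rightarrow> 'a \<Rightarrow> real"
  assumes "\<And>u v. f u v = f v u"
  shows "(\<Sum>(u, v)\<in>arcs_ends G. f u v) = 2 * (\<Sum>e\<in>edges G. on_pair f e)"
  unfolding edges_def
proof (rule sum_ordered_pairs_eq_twice_unordered)
  show "sym (arcs_ends G)"
    using sym_arcs by (simp add: symmetric_def)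
  show "irrefl (arcs_ends G)"
    using adj_not_same by (auto simp: irrefl_def)
qed (fact finite_arcs_ends, fact assms)

lemma (in graph) handshake: "(\<Sum>v\<in>verts G. real (deg G v)) = 2 * real (card (edges G))"
proof -
  have "(\<Sum>v\<in>verts G. deg G v) = card (\<Union>v\<in>verts G. out_arcs G v)"
    unfolding out_degree_def by (rule card_UN_disjoint[symmetric]) auto
  also have "(\<Union>v\<in>verts G. out_arcs G v) = arcs G"
    by auto
  also have "card (arcs G) = card (arcs_ends G)"
    unfolding arcs_ends_def by (rule card_image[symmetric]) (rule inj_on_arc_to_ends)
  finally have "real (\<Sum>v\<in>verts G. deg G v) = (\<Sum>(u, v)\<in>arcs_ends G. 1)"
    by simp
  also have "\<dots> = 2 * (\<Sum>e\<in>edges G. on_pair (\<lambda>_ _. 1) e)"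
    by (rule sum_arcs_ends_eq_twice_sum_edges) simp
  also have "(\<Sum>e\<in>edges G. on_pair (\<lambda>_ _. 1 :: real) e) = (\<Sum>e\<in>edges G. 1)"
    by (rule sum.cong) (auto simp: edges_def on_pair_eq)
  finally show ?thesis
    by simp
qed

lemma (in graph) sum_pairs_squared_difference:
  "(\<Sum>e\<in>vertex_pairs G. on_pair (\<lambda>u v. (real (deg G u) - real (deg G v))\<^sup>2) e)
     = real (card (verts G)) * first_zagreb G - 4 * (real (card (edges G)))\<^sup>2"
proof -
  let ?f = "\<lambda>u v. (real (deg G u) - real (deg G v))\<^sup>2"
  let ?R = "{(u, v). u \<in> verts G \<and> v \<in> verts G \<and> u \<noteq> v}"
  have "?R \<subseteq> verts G \<times> verts G"
    by auto
  then have "2 * (\<Sum>e\<in>vertex_pairs G. on_pair ?f e) = (\<Sum>(u, v)\<in>?R. ?f u v)"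
    unfolding vertex_pairs_conv
    by (intro sum_ordered_pairs_eq_twice_unordered[symmetric])
       (auto intro: finite_subset symI simp: irrefl_def power2_commute)
  also have "\<dots> = (\<Sum>(u, v)\<in>verts G \<times> verts G. ?f u v)"
    \<comment> \<open>the diagonal contributes nothing\<close>
    by (rule sum.mono_neutral_left) auto
  also have "\<dots> = (\<Sum>u\<in>verts G. \<Sum>v\<in>verts G. ?f u v)"
    by (simp add: sum.cartesian_product)
  finally show ?thesis
    by (simp add: sum_squared_differences handshake first_zagreb_def power_mult_distrib)
qed

lemma (in graph) deg_pos:
  assumes "Digraph_Component.connected G" and "\<not> regular G" and "v \<in> verts G"
  shows "deg G v > 0"
proof -
  obtain w where "w \<in> verts G" "w \<noteq> v"
    using assms(2,3) unfolding regular_def by metis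
  moreover have "strongly_connected G"
    using assms(1) sym_arcs by (intro symmetric_connected_imp_strongly_connected)
  ultimately have "v \<rightarrow>\<^sup>+\<^bsub>G\<^esub> w"
    using assms(3) by (auto simp: strongly_connected_def)
  then obtain u where "v \<rightarrow>\<^bsub>G\<^esub> u"
    by (blast dest: tranclD)
  then have "out_arcs G v \<noteq> {}"
    by (fastforce elim: reachableE)
  then show ?thesis
    by (simp add: out_degree_def card_gt_0_iff finite_out_arcs)
qed

text \<open>
  The estimate \<open>t\<^sup>2 \<le> (\<Delta> - \<delta>) t\<close> is spent on the non-adjacent pairs only: the squares over the edges
  are cancelled by \<open>\<sigma>\<close>, so the share of the edges in the total irregularity survives intact.
\<close>

lemma (in graph) sum_edges_difference_le:
  assumes "min_degree G < max_degree G"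
  shows "(\<Sum>e\<in>edges G. on_pair (\<lambda>u v. \<bar>real (deg G u) - real (deg G v)\<bar>) e)
     \<le> total_irregularity G
        - (real (card (verts G)) * first_zagreb G - 4 * (real (card (edges G)))\<^sup>2
            - sigma_irregularity G) / (real (max_degree G) - real (min_degree G))"
proof -
  let ?abs = "on_pair (\<lambda>u v. \<bar>real (deg G u) - real (deg G v)\<bar>)"
  let ?sq = "on_pair (\<lambda>u v. (real (deg G u) - real (deg G v))\<^sup>2)"
  define D where "D = real (max_degree G) - real (min_degree G)"
  have "D > 0"
    using assms by (simp add: D_def)
  have le: "?sq e \<le> D * ?abs e" if "e \<in> vertex_pairs G" for e
  proof -
    from that obtain u v where uv: "e = {u, v}" "u \<in> verts G" "v \<in> verts G"
      by (auto simp: vertex_pairs_def)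
    let ?t = "\<bar>real (deg G u) - real (deg G v)\<bar>"
    have "?t \<le> D"
      unfolding D_def using uv(2,3)[THEN min_degree_le_deg] uv(2,3)[THEN deg_le_max_degree] by linarith
    then have "?t * ?t \<le> D * ?t"
      by (intro mult_right_mono) simp_all
    then show ?thesis
      by (simp add: uv(1) on_pair_eq power2_commute abs_minus_commute flip: power2_eq_square)
  qed
  have split: "sum g (vertex_pairs G) - sum g (edges G) = sum g (vertex_pairs G - edges G)"
    for g :: "'a set \<Rightarrow> real"
    using finite_vertex_pairs edges_subset_vertex_pairs by (simp add: sum_diff)
  have "sum ?sq (vertex_pairs G) - sum ?sq (edges G) \<le> D * (sum ?abs (vertex_pairs G) - sum ?abs (edges G))"
    unfolding split sum_distrib_left by (intro sum_mono le) simp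
  then have "(sum ?sq (vertex_pairs G) - sum ?sq (edges G)) / D
      \<le> sum ?abs (vertex_pairs G) - sum ?abs (edges G)"
    using \<open>D > 0\<close> by (simp add: pos_divide_le_eq mult.commute)
  then show ?thesis
    unfolding sum_pairs_squared_difference
    by (simp add: D_def total_irregularity_def sigma_irregularity_def)
qed

section \<open>The contribution of one edge\<close>

lemma sombor_term_le:
  fixes a b d :: real
  assumes "0 < d" and "d \<le> a" and "d \<le> b"
  shows "sqrt (a\<^sup>2 + b\<^sup>2) / (a + b) \<le> 1 / sqrt 2 + 1 / (4 * sqrt 2 * d) * \<bar>a - b\<bar>"
proof -
  define s t where "s = a + b" and "t = \<bar>a - b\<bar>"
  have st: "0 \<le> t" "t \<le> s" "2 * d \<le> s" "0 < s"
    using assms by (auto simp: s_def t_def)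
  have "t * t \<le> s * t"
    using st by (intro mult_right_mono)
  then have "s\<^sup>2 + t\<^sup>2 \<le> (s + t / 2)\<^sup>2"
    using zero_le_square[of t] by (simp only: power2_eq_square algebra_simps)
  then have "sqrt (s\<^sup>2 + t\<^sup>2) \<le> s + t / 2"
    using st by (intro real_le_lsqrt) auto
  moreover have "sqrt 2 * sqrt (a\<^sup>2 + b\<^sup>2) = sqrt (s\<^sup>2 + t\<^sup>2)"
    by (simp add: s_def t_def power2_sum power2_diff flip: real_sqrt_mult)
  ultimately have "sqrt 2 * (sqrt (a\<^sup>2 + b\<^sup>2) / s) \<le> 1 + t / (2 * s)"
    using st by (simp add: field_simps)
  also have "t / (2 * s) \<le> t / (4 * d)"
    using st assms by (intro divide_left_mono) auto
  finally have "sqrt (a\<^sup>2 + b\<^sup>2) / s \<le> (1 + t / (4 * d)) / sqrt 2"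
    by (simp add: pos_le_divide_eq mult.commute)
  also have "\<dots> = 1 / sqrt 2 + 1 / (4 * sqrt 2 * d) * t"
    by (simp add: add_divide_distrib mult.commute mult.left_commute)
  finally show ?thesis
    by (simp add: s_def t_def)
qed

lemma sombor_term_equal_degrees:
  fixes a :: real
  assumes "0 < a"
  shows "sqrt (a\<^sup>2 + a\<^sup>2) / (a + a) = 1 / sqrt 2"
proof -
  have "sqrt (a\<^sup>2 + a\<^sup>2) = sqrt 2 * a"
    using assms by (simp add: real_sqrt_mult flip: mult_2)
  then show ?thesis
    using assms by (simp add: field_simps)
qed

section \<open>The bound on the diminished Sombor index\<close>

lemma (in graph) diminished_sombor_le:
  assumes "Digraph_Component.connected G" and "\<not> regular G"
  shows "diminished_sombor G \<le> real (card (edges G)) / sqrt 2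
     + 1 / (4 * sqrt 2 * real (min_degree G)) *
         (\<Sum>e\<in>edges G. on_pair (\<lambda>u v. \<bar>real (deg G u) - real (deg G v)\<bar>) e)"
proof -
  let ?abs = "on_pair (\<lambda>u v. \<bar>real (deg G u) - real (deg G v)\<bar>)"
  let ?c = "1 / (4 * sqrt 2 * real (min_degree G))"
  have "verts G \<noteq> {}"
    using assms(2) by (auto simp: regular_def)
  then have "min_degree G \<in> deg G ` verts G"
    unfolding min_degree_def by (intro Min_in) auto
  then have "min_degree G > 0"
    using deg_pos[OF assms] by auto
  have "diminished_sombor G \<le> (\<Sum>e\<in>edges G. 1 / sqrt 2 + ?c * ?abs e)"
    unfolding diminished_sombor_def
  proof (rule sum_mono)
    fix e assume "e \<in> edges G"
    then obtain u v where uv: "e = {u, v}" "u \<in> verts G" "v \<in> verts G"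
      using adj_in_verts by (auto simp: edges_def)
    have "sqrt ((real (deg G u))\<^sup>2 + (real (deg G v))\<^sup>2) / (real (deg G u) + real (deg G v))
        \<le> 1 / sqrt 2 + ?c * \<bar>real (deg G u) - real (deg G v)\<bar>"
      using \<open>min_degree G > 0\<close> uv(2,3)[THEN min_degree_le_deg]
      by (intro sombor_term_le) simp_all
    then show "on_pair (\<lambda>u v. sqrt ((real (deg G u))\<^sup>2 + (real (deg G v))\<^sup>2)
        / (real (deg G u) + real (deg G v))) e \<le> 1 / sqrt 2 + ?c * ?abs e"
      by (simp add: uv(1) on_pair_eq add.commute abs_minus_commute)
  qed
  then show ?thesis
    by (simp add: sum.distrib sum_distrib_left)
qed

lemma (in graph) diminished_sombor_regular:
  assumes "regular G"
  shows "diminished_sombor G = real (card (edges G)) / sqrt 2"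
proof -
  from assms obtain k where k: "\<And>v. v \<in> verts G \<Longrightarrow> deg G v = k"
    by (auto simp: regular_def)
  have "diminished_sombor G = (\<Sum>e\<in>edges G. 1 / sqrt 2)"
    unfolding diminished_sombor_def
  proof (rule sum.cong[OF refl])
    fix e assume "e \<in> edges G"
    then obtain u v where uv: "e = {u, v}" "u \<rightarrow>\<^bsub>G\<^esub> v"
      by (auto simp: edges_def)
    \<comment> \<open>an endpoint of an edge is not isolated, so the quotient is not \<open>0 / 0\<close>\<close>
    from uv(2) have "out_arcs G u \<noteq> {}"
      by (fastforce elim: reachableE)
    then have "deg G u > 0"
      by (simp add: out_degree_def card_gt_0_iff finite_out_arcs)
    then have "k > 0" "deg G u = k" "deg G v = k"
      using k adj_in_verts[OF uv(2)] by auto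
    then show "on_pair (\<lambda>u v. sqrt ((real (deg G u))\<^sup>2 + (real (deg G v))\<^sup>2)
        / (real (deg G u) + real (deg G v))) e = 1 / sqrt 2"
      using sombor_term_equal_degrees[of "real k"] by (simp add: uv(1) on_pair_eq add.commute)
  qed
  then show ?thesis
    by simp
qed

lemma (in fin_digraph) min_degree_less_max_degree:
  assumes "\<not> regular G"
  shows "min_degree G < max_degree G"
proof (rule ccontr)
  assume "\<not> min_degree G < max_degree G"
  then have "deg G v = min_degree G" if "v \<in> verts G" for v
    using min_degree_le_deg[OF that] deg_le_max_degree[OF that] by linarith
  with assms show False
    by (auto simp: regular_def)
qed

theorem theorem13:
  fixes G :: "('a, 'b) pre_digraph" and n m \<Delta> \<delta> :: nat
  assumes "graph G" and "Digraph_Component.connected G"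
    and "n = card (verts G)" and "m = card (edges G)"
    and "\<Delta> = max_degree G" and "\<delta> = min_degree G"
  shows "(\<not> regular G \<longrightarrow>
           diminished_sombor G \<le> real m / sqrt 2 +
             1 / (4 * sqrt 2 * real \<delta>) *
               (total_irregularity G -
                 ((real n * first_zagreb G - 4 * (real m)\<^sup>2) - sigma_irregularity G) /
                   (real \<Delta> - real \<delta>)))
         \<and> (regular G \<longrightarrow> diminished_sombor G = real m / sqrt 2)"
proof -
  interpret graph G
    by fact
  show ?thesis
  proof (intro conjI impI)
    assume "\<not> regular G"
    have "1 / (4 * sqrt 2 * real (min_degree G)) *
        (\<Sum>e\<in>edges G. on_pair (\<lambda>u v. \<bar>real (deg G u) - real (deg G v)\<bar>) e)
      \<le> 1 / (4 * sqrt 2 * real \<delta>) *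
        (total_irregularity G -
          ((real n * first_zagreb G - 4 * (real m)\<^sup>2) - sigma_irregularity G) / (real \<Delta> - real \<delta>))"
      unfolding assms(3-6)
      by (intro mult_left_mono sum_edges_difference_le min_degree_less_max_degree \<open>\<not> regular G\<close>) simp
    with diminished_sombor_le[OF assms(2) \<open>\<not> regular G\<close>]
    show "diminished_sombor G \<le> real m / sqrt 2 +
        1 / (4 * sqrt 2 * real \<delta>) *
          (total_irregularity G -
            ((real n * first_zagreb G - 4 * (real m)\<^sup>2) - sigma_irregularity G) / (real \<Delta> - real \<delta>))"
      unfolding assms(4) by linarith
  next
    assume "regular G"
    then show "diminished_sombor G = real m / sqrt 2"
      unfolding assms(4) by (rule diminished_sombor_regular)
  qed
qed

end
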